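(* Let $\mathbb{K}$ be a field, $n\ge 2$ an integer, and let $m_1,\dots,m_n,p_1,\dots,p_n$ be non-negative integers. For each pair $(i,j)$ with $1\le j\le i\le n$ and $(i,j)\neq(n,1)$ let $A_{ij}\in\mathbb{K}^{m_i\times p_j}$ be given. For $X\in\mathbb{K}^{m_n\times p_1}$ and $i\in\{1,\dots,n\}$ let $H_i(X)$ be the block matrix formed by block rows $i,\dots,n$ and block columns $1,\dots,i$ of the block lower triangular array with blocks $A_{ij}$ and with $X$ in the $(n,1)$ position. Then there exists $X^\star\in\mathbb{K}^{m_n\times p_1}$ that simultaneously minimizes the ranks of all these matrices, i.e. for every $i\in\{1,\dots,n\}$ and every $X\in\mathbb{K}^{m_n\times p_1}$, $$\operatorname{rank} H_i(X^\star)\le \operatorname{rank} H_i(X).$$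
   Context: The block lower triangular array is $$\begin{bmatrix} A_{11} \\ A_{21} & A_{22} \\ \vdots & \vdots & \ddots \\ X & A_{n2} & \cdots & A_{nn}\end{bmatrix},$$ and explicitly $$H_1(X)=\begin{bmatrix} A_{11} \\ A_{21} \\ \vdots \\ X\end{bmatrix},\quad H_2(X)=\begin{bmatrix} A_{21}&A_{22} \\ \vdots&\vdots \\ X&A_{n2}\end{bmatrix},\ \ldots,\ H_n(X)=\begin{bmatrix} X&A_{n2}&\cdots&A_{nn}\end{bmatrix}.$$ Matrices are permitted to have zero rows or zero columns (and then have rank $0$). *)

theory Defs
  imports "Jordan_Normal_Form.DL_Rank"
begin

definition append_cols :: "'a::zero mat \<Rightarrow> 'a mat \<Rightarrow> 'a mat"  (infixr \<open>@\<^sub>c\<close> 65) where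
  "A @\<^sub>c B = four_block_mat A B (0\<^sub>m 0 (dim_col A)) (0\<^sub>m 0 (dim_col B))"

text \<open>
  The block matrix whose block rows are indexed by the list \<open>is\<close> and whose block columns are
  indexed by the list \<open>js\<close>. The size functions \<open>m\<close> and \<open>p\<close> are needed because an empty list of
  columns (rows) still has to produce a matrix with the right number of rows (columns).
\<close>

definition block_row :: "(nat \<Rightarrow> nat) \<Rightarrow> (nat \<Rightarrow> nat \<Rightarrow> 'a::zero mat) \<Rightarrow> nat \<Rightarrow> nat list \<Rightarrow> 'a mat" where
  "block_row m B i js = foldr (@\<^sub>c) (map (B i) js) (0\<^sub>m (m i) 0)"

definition block_mat :: "(nat \<Rightarrow> nat) \<Rightarrow> (nat \<Rightarrow> nat) \<Rightarrow> (nat \<Rightarrow> nat \<Rightarrow> 'a::zero mat)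
    \<Rightarrow> nat list \<Rightarrow> nat list \<Rightarrow> 'a mat" where
  "block_mat m p B is js =
     foldr (@\<^sub>r) (map (\<lambda>i. block_row m B i js) is) (0\<^sub>m 0 (sum_list (map p js)))"

text \<open>
  Rows \<open>i, \<dots>, n\<close> and columns \<open>1, \<dots>, i\<close> only involve blocks \<open>(k, j)\<close> with \<open>j \<le> i \<le> k\<close>, so the
  part of the array above the diagonal never enters.
\<close>

definition H :: "nat \<Rightarrow> (nat \<Rightarrow> nat) \<Rightarrow> (nat \<Rightarrow> nat) \<Rightarrow> (nat \<Rightarrow> nat \<Rightarrow> 'a::zero mat)
    \<Rightarrow> nat \<Rightarrow> 'a mat \<Rightarrow> 'a mat" where
  "H n m p A i X =
     block_mat m p (\<lambda>k j. if k = n \<and> j = 1 then X else A k j) [i..<Suc n] [1..<Suc i]"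

text \<open>The locale constant \<open>vec_space.rank\<close> takes the number of rows as its first argument.\<close>

definition mat_rank :: "'a::field mat \<Rightarrow> nat" where
  "mat_rank M = vec_space.rank (dim_row M) M"

lemma append_cols_carrier:
  "A \<in> carrier_mat r c \<Longrightarrow> B \<in> carrier_mat r d \<Longrightarrow> A @\<^sub>c B \<in> carrier_mat r (c + d)"
  by (auto simp: append_cols_def)

lemma index_append_cols:
  assumes "A \<in> carrier_mat r c" "B \<in> carrier_mat r d" "k < r" "l < c + d"
  shows "(A @\<^sub>c B) $$ (k, l) = (if l < c then A $$ (k, l) else B $$ (k, l - c))"
  using assms by (auto simp: append_cols_def)

lemma block_row_carrier:
  assumes "\<And>j. j \<in> set js \<Longrightarrow> B i j \<in> carrier_mat (m i) (p j)"
  shows "block_row m B i js \<in> carrier_mat (m i) (sum_list (map p js))"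
  using assms by (induction js) (auto simp: block_row_def intro!: append_cols_carrier)

lemma block_mat_carrier:
  assumes "\<And>i j. i \<in> set is \<Longrightarrow> j \<in> set js \<Longrightarrow> B i j \<in> carrier_mat (m i) (p j)"
  shows "block_mat m p B is js \<in> carrier_mat (sum_list (map m is)) (sum_list (map p js))"
  using assms
proof (induction "is")
  case (Cons i "is")
  have "block_row m B i js \<in> carrier_mat (m i) (sum_list (map p js))"
    using Cons.prems by (intro block_row_carrier) auto
  moreover have "block_mat m p B is js
      \<in> carrier_mat (sum_list (map m is)) (sum_list (map p js))"
    using Cons by auto
  ultimately show ?case
    by (auto simp: block_mat_def intro!: carrier_append_rows)
qed (auto simp: block_mat_def)

lemma H_carrier:
  assumes "\<And>k j. 1 \<le> j \<Longrightarrow> j \<le> k \<Longrightarrow> k \<le> n \<Longrightarrow> (k, j) \<noteq> (n, 1) \<Longrightarrow>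
             A k j \<in> carrier_mat (m k) (p j)"
    and "X \<in> carrier_mat (m n) (p 1)"
  shows "H n m p A i X \<in> carrier_mat (\<Sum>k\<leftarrow>[i..<Suc n]. m k) (\<Sum>j\<leftarrow>[1..<Suc i]. p j)"
  unfolding H_def using assms by (intro block_mat_carrier) auto

end

theory Submission
  imports Defs "HOL-Library.Function_Algebras"
begin

text \<open>
  Write \<open>H\<^sub>i(X)\<close> as a two-by-two block matrix with top blocks \<open>P\<^sub>i\<close>, \<open>Q\<^sub>i\<close> and bottom blocks \<open>X\<close>, \<open>R\<^sub>i\<close>,
  and let \<open>G\<^sub>i\<close> be the linear relation of all pairs \<open>(u, R\<^sub>i w)\<close> with \<open>P\<^sub>i u = Q\<^sub>i w\<close>. Projecting the column
  space of \<open>H\<^sub>i(X)\<close> to the top rows gives an image independent of \<open>X\<close> and a kernel that always contains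
  the vectors \<open>R\<^sub>i w\<close> with \<open>Q\<^sub>i w = 0\<close>; the kernel is exactly that if \<open>(u, X u) \<in> G\<^sub>i\<close> for all \<open>u\<close> in the
  domain of \<open>G\<^sub>i\<close>, so such an \<open>X\<close> minimizes the rank. Passing from \<open>i\<close> to \<open>i + 1\<close> drops rows of
  \<open>P\<^sub>i\<close> and adds columns to \<open>Q\<^sub>i\<close> and \<open>R\<^sub>i\<close>, so \<open>G\<^sub>1 \<subseteq> \<dots> \<subseteq> G\<^sub>n\<close>. Choosing values on a basis adapted to the
  resulting chain of domains yields one \<open>X\<close> that is a selection of every \<open>G\<^sub>i\<close>.
\<close>

section \<open>Linear selections of a chain of linear relations\<close>

text \<open>A basis of \<open>D\<close> extends to an independent set spanning the domain of
  \<open>G\<close>. Keeping \<open>g\<close> on the old basis vectors and taking arbitrary related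
  values on the new ones determines \<open>h\<close>; closure of \<open>G\<close> under linear
  operations carries the selection property from the basis to its span.\<close>

lemma (in vector_space_pair) linear_selection_extend:
  assumes g: "Vector_Spaces.linear s1 s2 g" and D: "vs1.subspace D"
    and gG: "\<And>u. u \<in> D \<Longrightarrow> (u, g u) \<in> G"
    and zero: "(0, 0) \<in> G"
    and add: "\<And>u v u' v'. (u, v) \<in> G \<Longrightarrow> (u', v') \<in> G \<Longrightarrow> (u + u', v + v') \<in> G"
    and scale: "\<And>c u v. (u, v) \<in> G \<Longrightarrow> (s1 c u, s2 c v) \<in> G"
  obtains h where "Vector_Spaces.linear s1 s2 h" "\<And>u. u \<in> D \<Longrightarrow> h u = g u"
    "\<And>u. u \<in> Domain G \<Longrightarrow> (u, h u) \<in> G"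
proof -
  obtain B where B: "B \<subseteq> D" "vs1.independent B" "D \<subseteq> vs1.span B"
    using vs1.maximal_independent_subset by metis
  have "B \<subseteq> Domain G" using B(1) gG by blast
  then obtain B' where B': "B \<subseteq> B'" "B' \<subseteq> Domain G" "vs1.independent B'" "Domain G \<subseteq> vs1.span B'"
    using vs1.maximal_independent_subset_extend[OF _ B(2)] by metis
  \<comment> \<open>The choice is meaningful on all of \<open>B'\<close>, because \<open>B'\<close>
    lies in \<open>Domain G\<close>.\<close>
  define f where "f b = (if b \<in> B then g b else SOME v. (b, v) \<in> G)" for b
  obtain h where h: "Vector_Spaces.linear s1 s2 h" "\<forall>b\<in>B'. h b = f b"
    using linear_independent_extend[OF B'(3)] by blast
  interpret h: Vector_Spaces.linear s1 s2 h by (rule h(1))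
  have hG: "(b, h b) \<in> G" if "b \<in> B'" for b
  proof (cases "b \<in> B")
    case True
    then show ?thesis using h(2) that gG B(1) by (auto simp: f_def)
  next
    case False
    have "\<exists>v. (b, v) \<in> G" using that B'(2) by blast
    then show ?thesis using h(2) that False someI_ex[of "\<lambda>v. (b, v) \<in> G"] by (simp add: f_def)
  qed
  \<comment> \<open>The points at which \<open>h\<close> selects from \<open>G\<close> form a
    subspace, so containing \<open>B'\<close> forces it to contain the whole domain of
    \<open>G\<close>.\<close>
  have "vs1.subspace {u. (u, h u) \<in> G}"
    by (auto intro!: vs1.subspaceI simp: h.zero h.add h.scale zero add scale)
  then have "vs1.span B' \<subseteq> {u. (u, h u) \<in> G}"
    using hG by (intro vs1.span_minimal) auto
  moreover have "h u = g u" if "u \<in> D" for u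
  proof (rule linear_eq_on[OF h(1) g])
    show "u \<in> vs1.span B" using that B(3) by blast
    show "h b = g b" if "b \<in> B" for b using that h(2) B'(1) by (auto simp: f_def)
  qed
  ultimately show thesis using that[of h] h(1) B'(4) by blast
qed

text \<open>Induction along the chain: a selection for the earlier relations is altered only outside
  the largest earlier domain, so the earlier selection properties survive the extension to the next
  relation.\<close>

lemma (in vector_space_pair) nested_relations_linear_selection:
  fixes G :: "nat \<Rightarrow> ('b \<times> 'c) set"
  assumes zero: "\<And>i. i < N \<Longrightarrow> (0, 0) \<in> G i"
    and add: "\<And>i u v u' v'. i < N \<Longrightarrow> (u, v) \<in> G i \<Longrightarrow> (u', v') \<in> G i \<Longrightarrow> (u + u', v + v') \<in> G i"
    and scale: "\<And>i c u v. i < N \<Longrightarrow> (u, v) \<in> G i \<Longrightarrow> (s1 c u, s2 c v) \<in> G i"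
    and nested: "\<And>i. Suc i < N \<Longrightarrow> G i \<subseteq> G (Suc i)"
  shows "\<exists>h. Vector_Spaces.linear s1 s2 h \<and> (\<forall>i<N. \<forall>u\<in>Domain (G i). (u, h u) \<in> G i)"
  using assms
proof (induction N)
  case 0
  then show ?case using linear_zero by auto
next
  case (Suc N)
  obtain g where g: "Vector_Spaces.linear s1 s2 g" "\<forall>i<N. \<forall>u\<in>Domain (G i). (u, g u) \<in> G i"
    using Suc.IH[OF Suc.prems(1-4)] by auto
  \<comment> \<open>The largest domain handled so far. With no earlier relation, the zero subspace
    serves, where any linear map agrees with the pair \<open>(0, 0)\<close>.\<close>
  define D where "D = (if N = 0 then {0} else Domain (G (N - 1)))"
  interpret g: Vector_Spaces.linear s1 s2 g by (rule g(1))
  have D: "vs1.subspace D"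
    using Suc.prems(1-3)[of "N - 1"] by (fastforce intro!: vs1.subspaceI simp: D_def)
  have gG: "(u, g u) \<in> G N" if "u \<in> D" for u
  proof (cases N)
    case 0
    then show ?thesis using that Suc.prems(1) by (simp add: D_def g.zero)
  next
    case (Suc k)
    then show ?thesis using that g(2) \<open>\<And>i. Suc i < Suc N \<Longrightarrow> G i \<subseteq> G (Suc i)\<close>[of k]
      by (auto simp: D_def)
  qed
  obtain h where h: "Vector_Spaces.linear s1 s2 h" "\<And>u. u \<in> D \<Longrightarrow> h u = g u"
      "\<And>u. u \<in> Domain (G N) \<Longrightarrow> (u, h u) \<in> G N"
    using linear_selection_extend[OF g(1) D gG] Suc.prems(1-3)[of N] by blast
  have nested': "G k \<subseteq> G (Suc k)" if "Suc k < N" for k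
    using Suc.prems(4)[of k] that by simp
  have sub: "G i \<subseteq> G (N - 1)" if "i < N" for i
  proof -
    have "G i \<subseteq> G j" if "i \<le> j" "j < N" for j
      using that by (induction j rule: dec_induct) (use nested' in fastforce)+
    then show ?thesis using that by simp
  qed
  have "(u, h u) \<in> G i" if "i < Suc N" "u \<in> Domain (G i)" for i u
  proof (cases "i = N")
    case False
    then have "i < N" using that by simp
    then have "u \<in> D" using sub[of i] that(2) by (auto simp: D_def)
    then show ?thesis using h(2) g(2) that(2) \<open>i < N\<close> by simp
  qed (use h(3) that in simp)
  then show ?case using h(1) by blast
qed

section \<open>Transfer from abstract linear maps to matrices\<close>

text \<open>The abstract selection result concerns whole types, whereas \<open>'a vec\<close> mixes
  all dimensions. Sequences over the field form a vector space as a type, and \<open>vec r\<close>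
  truncates them linearly to dimension \<open>r\<close>.\<close>

lemma vector_space_fun: "vector_space (\<lambda>(c :: 'a :: field) f (i :: nat). c * f i)"
  by unfold_locales (auto simp: fun_eq_iff algebra_simps)

lemma nested_relations_mat_selection:
  fixes G :: "nat \<Rightarrow> ('a :: field vec \<times> 'a vec) set"
  assumes carrier: "\<And>i. i < N \<Longrightarrow> G i \<subseteq> carrier_vec p \<times> carrier_vec q"
    and zero: "\<And>i. i < N \<Longrightarrow> (0\<^sub>v p, 0\<^sub>v q) \<in> G i"
    and add: "\<And>i u v u' v'. i < N \<Longrightarrow> (u, v) \<in> G i \<Longrightarrow> (u', v') \<in> G i \<Longrightarrow> (u + u', v + v') \<in> G i"
    and scale: "\<And>i c u v. i < N \<Longrightarrow> (u, v) \<in> G i \<Longrightarrow> (c \<cdot>\<^sub>v u, c \<cdot>\<^sub>v v) \<in> G i"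
    and nested: "\<And>i. Suc i < N \<Longrightarrow> G i \<subseteq> G (Suc i)"
  obtains X where "X \<in> carrier_mat q p" "\<And>i u. i < N \<Longrightarrow> u \<in> Domain (G i) \<Longrightarrow> (u, X *\<^sub>v u) \<in> G i"
proof -
  define s where "s = (\<lambda>(c :: 'a) f (i :: nat). c * f i)"
  interpret S: vector_space s unfolding s_def by (rule vector_space_fun)
  interpret vector_space_pair s s ..
  \<comment> \<open>The preimage of \<open>G i\<close> under truncation inherits the closure
    properties and the nesting.\<close>
  define G' where "G' i = {(f, g). (vec p f, vec q g) \<in> G i}" for i
  have vec_add: "vec r (f + g) = vec r f + vec r g" for r and f g :: "nat \<Rightarrow> 'a" by (auto simp: plus_fun_def)
  have vec_scale: "vec r (s c f) = c \<cdot>\<^sub>v vec r f" for r c f by (auto simp: s_def)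
  have vec_0: "vec r 0 = 0\<^sub>v r" for r by auto
  have "\<exists>h. Vector_Spaces.linear s s h \<and> (\<forall>i<N. \<forall>u\<in>Domain (G' i). (u, h u) \<in> G' i)"
    using assms(2-4) subsetD[OF nested]
    by (intro nested_relations_linear_selection) (auto simp: G'_def vec_add vec_scale vec_0)
  then obtain h where h: "Vector_Spaces.linear s s h" "\<And>i u. i < N \<Longrightarrow> u \<in> Domain (G' i) \<Longrightarrow> (u, h u) \<in> G' i"
    by blast
  interpret h: Vector_Spaces.linear s s h by (rule h(1))
  define e where "e b = (\<lambda>c. if c = b then 1 else 0 :: 'a)" for b :: nat
  \<comment> \<open>Column \<open>b\<close> is the image of the \<open>b\<close>-th unit sequence,
    cut off after \<open>q\<close> entries.\<close>
  define X where "X = mat q p (\<lambda>(a, b). h (e b) a)"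
  have "(u, X *\<^sub>v u) \<in> G i" if i: "i < N" and u_dom: "u \<in> Domain (G i)" for i u
  proof -
    obtain v where v: "(u, v) \<in> G i" using u_dom by blast
    have u: "u \<in> carrier_vec p" and "v \<in> carrier_vec q" using v carrier[OF i] by auto
    \<comment> \<open>Padding \<open>u\<close> by zeros makes it a finite combination of unit
      sequences, so linearity determines \<open>h f\<close> from the columns of
      \<open>X\<close>.\<close>
    define f where "f = (\<lambda>c. if c < p then u $ c else 0)"
    have sum_apply: "(\<Sum>b\<in>A. F b) c = (\<Sum>b\<in>A. F b c)" for A c and F :: "nat \<Rightarrow> nat \<Rightarrow> 'a"
      by (induction A rule: infinite_finite_induct) auto
    have f: "f = (\<Sum>b<p. s (u $ b) (e b))"
      by (auto simp: f_def e_def s_def fun_eq_iff sum_apply if_distrib cong: if_cong)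
    have "h f = (\<Sum>b<p. s (u $ b) (h (e b)))"
      by (simp add: f h.sum h.scale)
    then have "vec q (h f) = X *\<^sub>v u"
      using u by (auto simp: X_def scalar_prod_def sum_apply s_def lessThan_atLeast0 mult.commute)
    moreover have vf: "vec p f = u" using u by (auto simp: f_def)
    moreover have "vec q (($) v) = v" using \<open>v \<in> carrier_vec q\<close> by auto
    \<comment> \<open>Only the first \<open>q\<close> values count, so the values of
      \<open>($) v\<close> beyond the dimension are harmless.\<close>
    then have "(f, ($) v) \<in> G' i" using v vf by (simp add: G'_def)
    then have "(f, h f) \<in> G' i" using h(2) i by blast
    ultimately show ?thesis by (simp add: G'_def)
  qed
  moreover have "X \<in> carrier_mat q p" by (simp add: X_def)
  ultimately show thesis using that by blast
qed

section \<open>Comparing ranks through the image and kernel of a projection\<close>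

text \<open>Independent sets in \<open>W\<close> stay independent in \<open>V\<close>, which bounds
  their size; a maximal one is a basis of \<open>W\<close>.\<close>

lemma (in vectorspace) fin_dim_subspace:
  assumes fd: "fin_dim" and W: "VectorSpace.subspace K W V"
  shows "vectorspace.fin_dim K (vs W)"
proof -
  interpret W: vectorspace K "vs W" using W by (rule subspace_is_vs)
  have sub: "W \<subseteq> carrier V" "submodule K W V"
    using W by (auto simp: VectorSpace.subspace_def submodule_def)
  have small: "finite S \<and> card S \<le> dim" if "S \<subseteq> W \<and> W.lin_indpt S" for S
    using that sub span_li_not_depend(2)[of S W] li_le_dim[OF fd, of S] by blast
  have "W.lin_indpt {}" by (auto simp: W.lin_dep_def)
  then obtain S where S: "finite S" "maximal S (\<lambda>S. S \<subseteq> W \<and> W.lin_indpt S)"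
    using maximal_exists[of "\<lambda>S. S \<subseteq> W \<and> W.lin_indpt S" dim "{}"] small by auto
  then have "W.basis S" by (intro W.max_li_is_basis) auto
  then show ?thesis using S(1) by (auto simp: W.fin_dim_def W.basis_def)
qed

lemma (in vectorspace) dim_subspace_mono:
  assumes fd: "fin_dim" and "VectorSpace.subspace K W V" "VectorSpace.subspace K W' V" "W \<subseteq> W'"
  shows "vectorspace.dim K (vs W) \<le> vectorspace.dim K (vs W')"
  using assms fin_dim_subspace[OF fd]
    vectorspace.subspace_dim[OF subspace_is_vs[OF assms(3)] nested_subspaces[OF assms(3,2,4)]]
  by auto

text \<open>Rank-nullity for multiplication by \<open>K\<close> restricted to the column space of
  \<open>M\<close>. The two subspace claims allow dimension monotonicity to be applied to each
  summand.\<close>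

lemma (in vec_space) rank_eq_dim_image_plus_dim_kernel:
  assumes K: "K \<in> carrier_mat k n" and M: "M \<in> carrier_mat n c"
  shows "VectorSpace.subspace class_ring ((*\<^sub>v) K ` col_space M) (module_vec TYPE('a) k)"
    and "VectorSpace.subspace class_ring {x \<in> col_space M. K *\<^sub>v x = 0\<^sub>v k} V"
    and "rank M = vectorspace.dim class_ring ((module_vec TYPE('a) k)\<lparr>carrier := (*\<^sub>v) K ` col_space M\<rparr>)
       + vectorspace.dim class_ring (vs {x \<in> col_space M. K *\<^sub>v x = 0\<^sub>v k})"
proof -
  have sub: "VectorSpace.subspace class_ring (col_space M) V"
    unfolding col_space_def using M cols_dim[of M] by (intro span_is_subspace) auto
  have C: "col_space M \<subseteq> carrier_vec n"
    using sub by (auto simp: VectorSpace.subspace_def submodule_def)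
  interpret W: vec_space "TYPE('a)" k .
  interpret C: vectorspace class_ring "vs (col_space M)" using sub by (rule subspace_is_vs)
  interpret T: linear_map class_ring "vs (col_space M)" "module_vec TYPE('a) k" "(*\<^sub>v) K"
  proof unfold_locales
    show "(*\<^sub>v) K \<in> LinearCombinations.module_hom class_ring (vs (col_space M)) (module_vec TYPE('a) k)"
      using K C by (auto simp: LinearCombinations.module_hom_def module_vec_simps mult_add_distrib_mat_vec[OF K] mult_mat_vec[OF K] subset_iff)
  qed
  have im: "T.imT = (*\<^sub>v) K ` col_space M" by (simp add: T.im_def)
  have ker: "T.kerT = {x \<in> col_space M. K *\<^sub>v x = 0\<^sub>v k}" by (auto simp: T.ker_def module_vec_simps)
  show "VectorSpace.subspace class_ring ((*\<^sub>v) K ` col_space M) (module_vec TYPE('a) k)"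
    using T.imT_is_subspace im by simp
  have "VectorSpace.subspace class_ring T.kerT (vs (col_space M))" by (rule T.kerT_is_subspace)
  then show "VectorSpace.subspace class_ring {x \<in> col_space M. K *\<^sub>v x = 0\<^sub>v k} V"
    unfolding ker using C by (auto simp: VectorSpace.subspace_def submodule_def vec_vs subset_iff intro: vec_module)
  have "C.fin_dim" unfolding col_space_def by (rule fin_dim_span_cols[OF M])
  from T.rank_nullity[OF this]
  show "rank M = vectorspace.dim class_ring ((module_vec TYPE('a) k)\<lparr>carrier := (*\<^sub>v) K ` col_space M\<rparr>)
       + vectorspace.dim class_ring (vs {x \<in> col_space M. K *\<^sub>v x = 0\<^sub>v k})"
    unfolding im ker by (simp add: rank_def col_space_def)
qed

text \<open>The hypotheses are inclusions of images and of kernels, written in coefficient vectors;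
  each bounds one summand of the rank.\<close>

lemma (in vec_space) rank_mono_via_image_kernel:
  assumes K: "K \<in> carrier_mat k n" and M: "M \<in> carrier_mat n c" and M': "M' \<in> carrier_mat n c'"
    and im: "\<And>v. v \<in> carrier_vec c \<Longrightarrow> \<exists>v'\<in>carrier_vec c'. K *\<^sub>v (M *\<^sub>v v) = K *\<^sub>v (M' *\<^sub>v v')"
    and ker: "\<And>v. v \<in> carrier_vec c \<Longrightarrow> K *\<^sub>v (M *\<^sub>v v) = 0\<^sub>v k \<Longrightarrow> \<exists>v'\<in>carrier_vec c'. M *\<^sub>v v = M' *\<^sub>v v'"
  shows "rank M \<le> rank M'"
proof -
  interpret W: vec_space "TYPE('a)" k .
  note r = rank_eq_dim_image_plus_dim_kernel[OF K M]
  note r' = rank_eq_dim_image_plus_dim_kernel[OF K M']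
  have "(*\<^sub>v) K ` col_space M \<subseteq> (*\<^sub>v) K ` col_space M'"
    using M M' im by (fastforce simp: col_space_eq)
  moreover have "{x \<in> col_space M. K *\<^sub>v x = 0\<^sub>v k} \<subseteq> {x \<in> col_space M'. K *\<^sub>v x = 0\<^sub>v k}"
    using M M' ker by (fastforce simp: col_space_eq)
  ultimately show ?thesis
    unfolding r(3) r'(3)
    by (intro add_mono W.dim_subspace_mono dim_subspace_mono r r' W.fin_dim fin_dim)
qed

section \<open>Two-by-two block matrices with a varying lower left block\<close>

lemma mult_mat_zero_vec:
  fixes A :: "'a :: semiring_0 mat"
  assumes "A \<in> carrier_mat r c"
  shows "A *\<^sub>v 0\<^sub>v c = 0\<^sub>v r"
  using assms by (intro eq_vecI) auto

lemma append_cols_mult_vec: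
  fixes A :: "'a :: comm_semiring_0 mat"
  assumes A: "A \<in> carrier_mat r c" and B: "B \<in> carrier_mat r d"
    and u: "u \<in> carrier_vec c" and w: "w \<in> carrier_vec d"
  shows "(A @\<^sub>c B) *\<^sub>v (u @\<^sub>v w) = A *\<^sub>v u + B *\<^sub>v w"
proof -
  have "(A @\<^sub>c B) *\<^sub>v (u @\<^sub>v w) =
      (A *\<^sub>v u + B *\<^sub>v w) @\<^sub>v (0\<^sub>m 0 c *\<^sub>v u + 0\<^sub>m 0 d *\<^sub>v w)"
    unfolding append_cols_def carrier_matD(2)[OF A] carrier_matD(2)[OF B] using A B u w
    by (intro four_block_mat_mult_vec) auto
  also have "\<dots> = A *\<^sub>v u + B *\<^sub>v w" using A B by (intro eq_vecI) auto
  finally show ?thesis .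
qed

text \<open>The projection to the top rows has the same image for \<open>X\<close> and
  \<open>Y\<close>. By \<open>sel\<close>, every kernel vector for \<open>X\<close> comes from the
  right-hand block columns alone, which both matrices share.\<close>

lemma rank_four_block_mat_le:
  fixes P :: "'a :: field mat"
  assumes P: "P \<in> carrier_mat a c" and Q: "Q \<in> carrier_mat a d"
    and R: "R \<in> carrier_mat b d" and X: "X \<in> carrier_mat b c" and Y: "Y \<in> carrier_mat b c"
    and sel: "\<And>u w. u \<in> carrier_vec c \<Longrightarrow> w \<in> carrier_vec d \<Longrightarrow> P *\<^sub>v u = Q *\<^sub>v w \<Longrightarrow>
      \<exists>w'\<in>carrier_vec d. X *\<^sub>v u = R *\<^sub>v w' \<and> P *\<^sub>v u = Q *\<^sub>v w'"
  shows "mat_rank (four_block_mat P Q X R) \<le> mat_rank (four_block_mat P Q Y R)"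
proof -
  \<comment> \<open>The projection to the first \<open>a\<close> coordinates.\<close>
  define K where "K = (1\<^sub>m a @\<^sub>c 0\<^sub>m a b :: 'a mat)"
  have K: "K \<in> carrier_mat a (a + b)" unfolding K_def by (intro append_cols_carrier) auto
  have top: "K *\<^sub>v (x @\<^sub>v y) = x" if "x \<in> carrier_vec a" "y \<in> carrier_vec b" for x y
    using that append_cols_mult_vec[of "1\<^sub>m a" a a "0\<^sub>m a b" b x y]
      mult_mat_vec[of "0\<^sub>m a b" a b y 0] by (simp add: K_def) (intro eq_vecI, auto)
  have M: "four_block_mat P Q Z R \<in> carrier_mat (a + b) (c + d)" for Z
    using P R by simp
  interpret vec_space "TYPE('a)" "a + b" .
  have "rank (four_block_mat P Q X R) \<le> rank (four_block_mat P Q Y R)"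
  proof (rule rank_mono_via_image_kernel[OF K M M])
    fix v :: "'a vec" assume "v \<in> carrier_vec (c + d)"
    then obtain u w where v: "v = u @\<^sub>v w" and u: "u \<in> carrier_vec c" and w: "w \<in> carrier_vec d"
      by (metis vec_first_carrier vec_first_last_append vec_last_carrier)
    have mult: "four_block_mat P Q Z R *\<^sub>v (u' @\<^sub>v w') = (P *\<^sub>v u' + Q *\<^sub>v w') @\<^sub>v (Z *\<^sub>v u' + R *\<^sub>v w')"
      if "Z \<in> carrier_mat b c" "u' \<in> carrier_vec c" "w' \<in> carrier_vec d" for Z u' w'
      using P Q R that by (intro four_block_mat_mult_vec) auto
    have top_mult: "K *\<^sub>v (four_block_mat P Q Z R *\<^sub>v v) = P *\<^sub>v u + Q *\<^sub>v w" if "Z \<in> carrier_mat b c" for Z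
      using P Q R u w that unfolding v by (simp add: mult) (intro top, auto)
    show "\<exists>v'\<in>carrier_vec (c + d). K *\<^sub>v (four_block_mat P Q X R *\<^sub>v v) = K *\<^sub>v (four_block_mat P Q Y R *\<^sub>v v')"
      using top_mult[OF X] top_mult[OF Y] \<open>v \<in> _\<close> by metis
    assume "K *\<^sub>v (four_block_mat P Q X R *\<^sub>v v) = 0\<^sub>v a"
    then have 0: "P *\<^sub>v u + Q *\<^sub>v w = 0\<^sub>v a" using top_mult[OF X] by simp
    \<comment> \<open>The sign change turns the kernel condition into the form required by
      \<open>sel\<close>.\<close>
    have "P *\<^sub>v u = Q *\<^sub>v (-1 \<cdot>\<^sub>v w)"
    proof (intro eq_vecI)
      fix i assume "i < dim_vec (Q *\<^sub>v (-1 \<cdot>\<^sub>v w))"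
      then have i: "i < a" using Q by simp
      have "(P *\<^sub>v u + Q *\<^sub>v w) $ i = 0" using 0 i by simp
      then show "(P *\<^sub>v u) $ i = (Q *\<^sub>v (-1 \<cdot>\<^sub>v w)) $ i"
        using i P Q by (simp add: mult_mat_vec[OF Q w] add_eq_0_iff)
    qed (use P Q in simp)
    then obtain w' where w': "w' \<in> carrier_vec d" "X *\<^sub>v u = R *\<^sub>v w'" "P *\<^sub>v u = Q *\<^sub>v w'"
      using sel[OF u, of "-1 \<cdot>\<^sub>v w"] w by auto
    \<comment> \<open>Replacing \<open>u\<close> by \<open>w'\<close> leaves both the top part and
      the bottom part unchanged; the zero first component then hides the lower left block.\<close>
    have "four_block_mat P Q X R *\<^sub>v v = four_block_mat P Q Y R *\<^sub>v (0\<^sub>v c @\<^sub>v (w' + w))"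
      unfolding v using P Q R X Y u w w' 0 mult_mat_zero_vec[OF P] mult_mat_zero_vec[OF Y]
      by (simp add: mult[OF X u w] mult[OF Y] mult_add_distrib_mat_vec[of _ _ d])
    moreover have "0\<^sub>v c @\<^sub>v (w' + w) \<in> carrier_vec (c + d)" using w w' by auto
    ultimately show "\<exists>v'\<in>carrier_vec (c + d). four_block_mat P Q X R *\<^sub>v v = four_block_mat P Q Y R *\<^sub>v v'"
      by blast
  qed
  then show ?thesis using P R by (simp add: mat_rank_def)
qed

section \<open>Splitting block matrices along rows and columns\<close>

lemma append_rows_assoc:
  assumes "dim_col A = dim_col B" "dim_col C = dim_col B"
  shows "(A @\<^sub>r B) @\<^sub>r C = A @\<^sub>r (B @\<^sub>r C)"
  using assms by (intro eq_matI) (auto simp: append_rows_def)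

lemma append_cols_assoc:
  assumes "dim_row A = dim_row B" "dim_row C = dim_row B"
  shows "(A @\<^sub>c B) @\<^sub>c C = A @\<^sub>c (B @\<^sub>c C)"
  using assms by (intro eq_matI) (auto simp: append_cols_def)

lemma append_cols_append_rows:
  assumes "P \<in> carrier_mat a c" "Q \<in> carrier_mat a d" "X \<in> carrier_mat b c" "R \<in> carrier_mat b d"
  shows "(P @\<^sub>c Q) @\<^sub>r (X @\<^sub>c R) = four_block_mat P Q X R"
  using assms by (intro eq_matI) (auto simp: append_rows_def append_cols_def)

lemma append_rows_append_cols:
  assumes "P \<in> carrier_mat a c" "Q \<in> carrier_mat a d" "X \<in> carrier_mat b c" "R \<in> carrier_mat b d"
  shows "(P @\<^sub>r X) @\<^sub>c (Q @\<^sub>r R) = four_block_mat P Q X R"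
  using assms by (intro eq_matI) (auto simp: append_rows_def append_cols_def)

lemma block_row_append:
  assumes "\<And>j. j \<in> set js \<union> set js' \<Longrightarrow> B i j \<in> carrier_mat (m i) (p j)"
  shows "block_row m B i (js @ js') = block_row m B i js @\<^sub>c block_row m B i js'"
  using assms
proof (induction js)
  case Nil
  have "block_row m B i js' \<in> carrier_mat (m i) (sum_list (map p js'))"
    using Nil by (intro block_row_carrier) auto
  then show ?case by (intro eq_matI) (auto simp: block_row_def append_cols_def)
next
  case (Cons j js)
  have "block_row m B i js' \<in> carrier_mat (m i) (sum_list (map p js'))"
    "block_row m B i js \<in> carrier_mat (m i) (sum_list (map p js))"
    using Cons.prems by (auto intro!: block_row_carrier)
  moreover have "B i j \<in> carrier_mat (m i) (p j)" using Cons.prems by simp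
  ultimately have "(B i j @\<^sub>c block_row m B i js) @\<^sub>c block_row m B i js' =
      B i j @\<^sub>c (block_row m B i js @\<^sub>c block_row m B i js')"
    by (intro append_cols_assoc) auto
  then show ?case using Cons by (simp add: block_row_def)
qed

lemma block_mat_Cons: "block_mat m p B (i # is) js = block_row m B i js @\<^sub>r block_mat m p B is js"
  by (simp add: block_mat_def)

lemma block_mat_append_rows:
  assumes "\<And>i j. i \<in> set is \<union> set is' \<Longrightarrow> j \<in> set js \<Longrightarrow> B i j \<in> carrier_mat (m i) (p j)"
  shows "block_mat m p B (is @ is') js = block_mat m p B is js @\<^sub>r block_mat m p B is' js"
  using assms
proof (induction "is")
  case Nil
  have "block_mat m p B is' js \<in> carrier_mat (sum_list (map m is')) (sum_list (map p js))"
    using Nil by (intro block_mat_carrier) auto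
  then show ?case by (intro eq_matI) (auto simp: block_mat_def append_rows_def)
next
  case (Cons i "is")
  have "block_mat m p B is js \<in> carrier_mat (sum_list (map m is)) (sum_list (map p js))"
    "block_mat m p B is' js \<in> carrier_mat (sum_list (map m is')) (sum_list (map p js))"
    "block_row m B i js \<in> carrier_mat (m i) (sum_list (map p js))"
    using Cons.prems by (auto intro!: block_mat_carrier block_row_carrier)
  then have "(block_row m B i js @\<^sub>r block_mat m p B is js) @\<^sub>r block_mat m p B is' js =
      block_row m B i js @\<^sub>r (block_mat m p B is js @\<^sub>r block_mat m p B is' js)"
    by (intro append_rows_assoc) auto
  then show ?case using Cons by (simp add: block_mat_Cons)
qed

text \<open>The induction over the rows rests on the interchange of stacking and juxtaposition: both
  orders of assembly give the same \<open>four_block_mat\<close>.\<close>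

lemma block_mat_append_cols:
  assumes "\<And>i j. i \<in> set is \<Longrightarrow> j \<in> set js \<union> set js' \<Longrightarrow> B i j \<in> carrier_mat (m i) (p j)"
  shows "block_mat m p B is (js @ js') = block_mat m p B is js @\<^sub>c block_mat m p B is js'"
  using assms
proof (induction "is")
  case Nil
  show ?case by (intro eq_matI) (auto simp: block_mat_def append_cols_def)
next
  case (Cons i "is")
  have c: "block_mat m p B is js \<in> carrier_mat (sum_list (map m is)) (sum_list (map p js))"
    "block_mat m p B is js' \<in> carrier_mat (sum_list (map m is)) (sum_list (map p js'))"
    "block_row m B i js \<in> carrier_mat (m i) (sum_list (map p js))"
    "block_row m B i js' \<in> carrier_mat (m i) (sum_list (map p js'))"
    using Cons.prems by (auto intro!: block_mat_carrier block_row_carrier)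
  have "block_row m B i (js @ js') = block_row m B i js @\<^sub>c block_row m B i js'"
    using Cons.prems by (intro block_row_append) auto
  then show ?case
    using Cons append_cols_append_rows[OF c(3,4,1,2)] append_rows_append_cols[OF c(3,4,1,2)]
    by (simp add: block_mat_Cons)
qed

lemma block_mat_single:
  assumes "B i j \<in> carrier_mat (m i) (p j)"
  shows "block_mat m p B [i] [j] = B i j"
  using assms by (intro eq_matI) (auto simp: block_mat_def block_row_def append_rows_def append_cols_def)

lemma block_mat_cong:
  assumes "\<And>i j. i \<in> set is \<Longrightarrow> j \<in> set js \<Longrightarrow> B i j = C i j"
  shows "block_mat m p B is js = block_mat m p C is js"
proof -
  have "block_row m B i js = block_row m C i js" if "i \<in> set is" for i
    unfolding block_row_def using assms that
    by (metis (mono_tags, lifting) map_cong)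
  then have "map (\<lambda>i. block_row m B i js) is = map (\<lambda>i. block_row m C i js) is"
    by simp
  then show ?thesis by (simp only: block_mat_def)
qed

text \<open>Separating the last block row and the first block column isolates \<open>X\<close>. For
  \<open>i = n\<close> the upper blocks have no rows; for \<open>i = 1\<close> the right-hand blocks
  have no columns.\<close>

lemma H_eq_four_block_mat:
  assumes A: "\<And>i j. 1 \<le> j \<Longrightarrow> j \<le> i \<Longrightarrow> i \<le> n \<Longrightarrow> (i, j) \<noteq> (n, 1) \<Longrightarrow>
      A i j \<in> carrier_mat (m i) (p j)"
    and X: "X \<in> carrier_mat (m n) (p 1)" and i: "1 \<le> i" "i \<le> n"
  shows "H n m p A i X = four_block_mat (block_mat m p A [i..<n] [1]) (block_mat m p A [i..<n] [2..<Suc i])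
      X (block_mat m p A [n] [2..<Suc i])"
proof -
  define B where "B k j = (if k = n \<and> j = 1 then X else A k j)" for k j
  have B: "B k j \<in> carrier_mat (m k) (p j)" if "1 \<le> j" "j \<le> k" "k \<le> n" for k j
    using A[OF that] X by (auto simp: B_def)
  have rows: "[i..<Suc n] = [i..<n] @ [n]" and cols: "[1..<Suc i] = [1] @ [2..<Suc i]"
    using i by (auto simp: upt_conv_Cons numeral_2_eq_2)
  have "H n m p A i X = block_mat m p B ([i..<n] @ [n]) ([1] @ [2..<Suc i])"
    unfolding H_def rows[symmetric] cols[symmetric] B_def ..
  also have "\<dots> = block_mat m p B [i..<n] ([1] @ [2..<Suc i]) @\<^sub>r block_mat m p B [n] ([1] @ [2..<Suc i])"
    using i by (intro block_mat_append_rows B) auto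
  also have "\<dots> = (block_mat m p B [i..<n] [1] @\<^sub>c block_mat m p B [i..<n] [2..<Suc i]) @\<^sub>r
      (block_mat m p B [n] [1] @\<^sub>c block_mat m p B [n] [2..<Suc i])"
    using i by (intro arg_cong2[of _ _ _ _ "(@\<^sub>r)"] block_mat_append_cols B) auto
  also have "\<dots> = four_block_mat (block_mat m p B [i..<n] [1]) (block_mat m p B [i..<n] [2..<Suc i])
      (block_mat m p B [n] [1]) (block_mat m p B [n] [2..<Suc i])"
    using i by (intro append_cols_append_rows[OF block_mat_carrier block_mat_carrier
          block_mat_carrier block_mat_carrier] B) auto
  also have "block_mat m p B [n] [1] = X"
    using block_mat_single[of B n 1 m p] X by (simp add: B_def)
  also have "block_mat m p B [i..<n] [1] = block_mat m p A [i..<n] [1]"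
    by (intro block_mat_cong) (auto simp: B_def)
  also have "block_mat m p B [i..<n] [2..<Suc i] = block_mat m p A [i..<n] [2..<Suc i]"
    by (intro block_mat_cong) (auto simp: B_def)
  also have "block_mat m p B [n] [2..<Suc i] = block_mat m p A [n] [2..<Suc i]"
    by (intro block_mat_cong) (auto simp: B_def)
  finally show ?thesis .
qed

section \<open>One selection for all the relations arising from the array\<close>

theorem theorem1:
  fixes n :: nat and m p :: "nat \<Rightarrow> nat" and A :: "nat \<Rightarrow> nat \<Rightarrow> 'a::field mat"
  assumes "n \<ge> 2"
    and "\<And>i j. 1 \<le> j \<Longrightarrow> j \<le> i \<Longrightarrow> i \<le> n \<Longrightarrow> (i, j) \<noteq> (n, 1) \<Longrightarrow>
           A i j \<in> carrier_mat (m i) (p j)"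
  shows "\<exists>Xstar \<in> carrier_mat (m n) (p 1).
           \<forall>i \<in> {1..n}. \<forall>X \<in> carrier_mat (m n) (p 1).
             mat_rank (H n m p A i Xstar) \<le> mat_rank (H n m p A i X)"
proof -
  note A = assms(2)
  define P where "P i = block_mat m p A [i..<n] [1]" for i
  define Q where "Q i = block_mat m p A [i..<n] [2..<Suc i]" for i
  define R where "R i = block_mat m p A [n] [2..<Suc i]" for i
  define rows where "rows i = sum_list (map m [i..<n])" for i
  define cols where "cols i = sum_list (map p [2..<Suc i])" for i
  have P: "P i \<in> carrier_mat (rows i) (p 1)" if "1 \<le> i" for i
    unfolding P_def rows_def using block_mat_carrier[of "[i..<n]" "[1]" A m p] A that by auto
  have Q: "Q i \<in> carrier_mat (rows i) (cols i)" for i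
    unfolding Q_def rows_def cols_def by (intro block_mat_carrier A) auto
  have R: "R i \<in> carrier_mat (m n) (cols i)" if "i \<le> n" for i
  proof -
    have "R i \<in> carrier_mat (sum_list (map m [n])) (cols i)"
      unfolding R_def cols_def using that by (intro block_mat_carrier A) auto
    then show ?thesis by simp
  qed
  \<comment> \<open>That \<open>(u, X u)\<close> lies in \<open>G i\<close> for every
    \<open>u\<close> in its domain is precisely the hypothesis \<open>sel\<close> of
    \<open>rank_four_block_mat_le\<close>.\<close>
  define G where "G i = {(u, R i *\<^sub>v w) | u w. u \<in> carrier_vec (p 1) \<and> w \<in> carrier_vec (cols i) \<and>
    P i *\<^sub>v u = Q i *\<^sub>v w}" for i
  have nested: "G i \<subseteq> G (Suc i)" if i: "1 \<le> i" "Suc i \<le> n" for i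
  proof
    fix z assume "z \<in> G i"
    then obtain u w where z: "z = (u, R i *\<^sub>v w)" and u: "u \<in> carrier_vec (p 1)"
      and w: "w \<in> carrier_vec (cols i)" and uw: "P i *\<^sub>v u = Q i *\<^sub>v w"
      by (auto simp: G_def)
    \<comment> \<open>Zero coefficients on the new block column leave all products
      unchanged.\<close>
    define w' where "w' = w @\<^sub>v 0\<^sub>v (p (Suc i))"
    \<comment> \<open>An intermediate stage: block row \<open>i\<close> is already removed, block
      column \<open>Suc i\<close> not yet added.\<close>
    define Q' where "Q' = block_mat m p A [Suc i..<n] [2..<Suc i]"
    have row_split: "[i..<n] = [i] @ [Suc i..<n]" using i by (simp add: upt_conv_Cons)
    have col_split: "[2..<Suc (Suc i)] = [2..<Suc i] @ [Suc i]" using i by simp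
    have Q': "Q' \<in> carrier_mat (rows (Suc i)) (cols i)"
      unfolding Q'_def rows_def cols_def by (intro block_mat_carrier A) auto
    have P1: "block_mat m p A [i] [1] \<in> carrier_mat (m i) (p 1)"
      using block_mat_carrier[of "[i]" "[1]" A m p] A i by auto
    have Q1: "block_mat m p A [i] [2..<Suc i] \<in> carrier_mat (m i) (cols i)"
    proof -
      have "block_mat m p A [i] [2..<Suc i] \<in> carrier_mat (sum_list (map m [i])) (cols i)"
        unfolding cols_def using i by (intro block_mat_carrier A) auto
      then show ?thesis by simp
    qed
    have "P i = block_mat m p A [i] [1] @\<^sub>r P (Suc i)"
      unfolding P_def row_split using i by (intro block_mat_append_rows A) auto
    moreover have "Q i = block_mat m p A [i] [2..<Suc i] @\<^sub>r Q'"
      unfolding Q_def Q'_def row_split using i by (intro block_mat_append_rows A) auto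
    ultimately have "(block_mat m p A [i] [1] *\<^sub>v u) @\<^sub>v (P (Suc i) *\<^sub>v u) =
        (block_mat m p A [i] [2..<Suc i] *\<^sub>v w) @\<^sub>v (Q' *\<^sub>v w)"
      using uw mat_mult_append[OF P1 P u] mat_mult_append[OF Q1 Q' w] by simp
    \<comment> \<open>Dropping block row \<open>i\<close> keeps only the lower part of the
      equation.\<close>
    then have PQ': "P (Suc i) *\<^sub>v u = Q' *\<^sub>v w"
      using P1 Q1 u w by (subst (asm) append_vec_eq[of _ "m i"]) auto
    have w': "w' \<in> carrier_vec (cols (Suc i))"
      using w unfolding w'_def cols_def col_split by simp
    have last: "block_mat m p A is [Suc i] \<in> carrier_mat (sum_list (map m is)) (p (Suc i))"
      if "\<And>k. k \<in> set is \<Longrightarrow> Suc i \<le> k \<and> k \<le> n" for "is"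
    proof -
      have "block_mat m p A is [Suc i] \<in> carrier_mat (sum_list (map m is)) (sum_list (map p [Suc i]))"
        using i that by (intro block_mat_carrier A) auto
      then show ?thesis by simp
    qed
    have "Q (Suc i) = Q' @\<^sub>c block_mat m p A [Suc i..<n] [Suc i]"
      unfolding Q_def Q'_def col_split using i by (intro block_mat_append_cols A) auto
    then have Qw': "Q (Suc i) *\<^sub>v w' = Q' *\<^sub>v w"
      using append_cols_mult_vec[OF Q' _ w, of _ "p (Suc i)"] last[of "[Suc i..<n]"] Q' w
      by (simp add: w'_def rows_def mult_mat_zero_vec)
    have "R (Suc i) = R i @\<^sub>c block_mat m p A [n] [Suc i]"
      unfolding R_def col_split using i by (intro block_mat_append_cols A) auto
    then have "R (Suc i) *\<^sub>v w' = R i *\<^sub>v w"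
      using append_cols_mult_vec[OF R _ w, of _ "p (Suc i)"] last[of "[n]"] R[of i] w i
      by (simp add: w'_def mult_mat_zero_vec)
    then show "z \<in> G (Suc i)" using u w' Qw' PQ' z unfolding G_def
      by (intro CollectI exI[of _ u] exI[of _ w']) simp
  qed
  obtain X where X: "X \<in> carrier_mat (m n) (p 1)"
    and sel: "\<And>i u. i < n \<Longrightarrow> u \<in> Domain (G (Suc i)) \<Longrightarrow> (u, X *\<^sub>v u) \<in> G (Suc i)"
  \<comment> \<open>The shift by \<open>Suc\<close> matches a chain indexed from 0 with block
    indices starting at 1.\<close>
  proof (rule nested_relations_mat_selection[of n "\<lambda>i. G (Suc i)" "p 1" "m n"])
    fix i assume "i < n"
    then have c: "P (Suc i) \<in> carrier_mat (rows (Suc i)) (p 1)"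
      "R (Suc i) \<in> carrier_mat (m n) (cols (Suc i))"
      "Q (Suc i) \<in> carrier_mat (rows (Suc i)) (cols (Suc i))"
      using P[of "Suc i"] Q[of "Suc i"] R[of "Suc i"] by auto
    show "G (Suc i) \<subseteq> carrier_vec (p 1) \<times> carrier_vec (m n)"
      using c by (auto simp: G_def)
    have "P (Suc i) *\<^sub>v 0\<^sub>v (p 1) = Q (Suc i) *\<^sub>v 0\<^sub>v (cols (Suc i))"
      "0\<^sub>v (m n) = R (Suc i) *\<^sub>v 0\<^sub>v (cols (Suc i))"
      using c by (simp_all add: mult_mat_zero_vec)
    then show "(0\<^sub>v (p 1), 0\<^sub>v (m n)) \<in> G (Suc i)"
      unfolding G_def by (auto intro!: exI[of _ "0\<^sub>v (cols (Suc i))"])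
    show "(u + u', v + v') \<in> G (Suc i)" if uv: "(u, v) \<in> G (Suc i)" "(u', v') \<in> G (Suc i)" for u v u' v'
    proof -
      obtain w w' where w: "v = R (Suc i) *\<^sub>v w" "u \<in> carrier_vec (p 1)"
          "w \<in> carrier_vec (cols (Suc i))" "P (Suc i) *\<^sub>v u = Q (Suc i) *\<^sub>v w"
        and w': "v' = R (Suc i) *\<^sub>v w'" "u' \<in> carrier_vec (p 1)"
          "w' \<in> carrier_vec (cols (Suc i))" "P (Suc i) *\<^sub>v u' = Q (Suc i) *\<^sub>v w'"
        using uv by (auto simp: G_def)
      then have "v + v' = R (Suc i) *\<^sub>v (w + w')"
        "P (Suc i) *\<^sub>v (u + u') = Q (Suc i) *\<^sub>v (w + w')"
        using c by (simp_all add: mult_add_distrib_mat_vec)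
      then show ?thesis using w w' unfolding G_def by (auto intro!: exI[of _ "w + w'"])
    qed
    show "(k \<cdot>\<^sub>v u, k \<cdot>\<^sub>v v) \<in> G (Suc i)" if uv: "(u, v) \<in> G (Suc i)" for k u v
    proof -
      obtain w where w: "v = R (Suc i) *\<^sub>v w" "u \<in> carrier_vec (p 1)"
          "w \<in> carrier_vec (cols (Suc i))" "P (Suc i) *\<^sub>v u = Q (Suc i) *\<^sub>v w"
        using uv by (auto simp: G_def)
      then have "k \<cdot>\<^sub>v v = R (Suc i) *\<^sub>v (k \<cdot>\<^sub>v w)"
        "P (Suc i) *\<^sub>v (k \<cdot>\<^sub>v u) = Q (Suc i) *\<^sub>v (k \<cdot>\<^sub>v w)"
        using c by (simp_all add: mult_mat_vec)
      then show ?thesis using w unfolding G_def by (auto intro!: exI[of _ "k \<cdot>\<^sub>v w"])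
    qed
  next
    show "G (Suc i) \<subseteq> G (Suc (Suc i))" if "Suc i < n" for i using nested[of "Suc i"] that by simp
  qed blast
  have "mat_rank (H n m p A i X) \<le> mat_rank (H n m p A i Y)"
    if i: "i \<in> {1..n}" and Y: "Y \<in> carrier_mat (m n) (p 1)" for i Y
  proof -
    have sel_i: "\<exists>w'\<in>carrier_vec (cols i). X *\<^sub>v u = R i *\<^sub>v w' \<and> P i *\<^sub>v u = Q i *\<^sub>v w'"
      if "u \<in> carrier_vec (p 1)" "w \<in> carrier_vec (cols i)" "P i *\<^sub>v u = Q i *\<^sub>v w" for u w
    proof -
      \<comment> \<open>The given \<open>w\<close> only places \<open>u\<close> in the domain; the
        selection supplies a possibly different \<open>w'\<close> that also reproduces
        \<open>X u\<close>.\<close>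
      have "u \<in> Domain (G i)" using that by (auto simp: G_def)
      then have "(u, X *\<^sub>v u) \<in> G i" using sel[of "i - 1" u] i by (cases i) auto
      then show ?thesis by (auto simp: G_def)
    qed
    have "mat_rank (four_block_mat (P i) (Q i) X (R i)) \<le> mat_rank (four_block_mat (P i) (Q i) Y (R i))"
      using i by (intro rank_four_block_mat_le[OF P Q R X Y sel_i]) auto
    moreover have "H n m p A i Z = four_block_mat (P i) (Q i) Z (R i)" if "Z \<in> carrier_mat (m n) (p 1)" for Z
      unfolding P_def Q_def R_def using i that by (intro H_eq_four_block_mat A) auto
    ultimately show ?thesis using X Y by simp
  qed
  then show ?thesis using X by blast
qed

end
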